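(* Let $\mathscr{C}$ be a noetherian EI category. Then every Grothendieck topology on $\mathscr{C}^{\mathrm{op}}$ is rigid.
   Context: For a small skeletal category $\mathscr{C}$ write $x \leqslant y$ if $\mathscr{C}(x,y) \neq \emptyset$. $\mathscr{C}$ is directed if it is small, skeletal, and $\leqslant$ is a partial order on $\mathrm{Ob}(\mathscr{C})$. A noetherian EI category is a directed category in which $(\mathrm{Ob}(\mathscr{C}),\leqslant)$ satisfies the ascending chain condition and every endomorphism is an isomorphism (endomorphism monoids need not be finite). A sieve on $x$ in $\mathscr{C}^{\mathrm{op}}$ is a subfunctor $S \subseteq \mathscr{C}(x,-)$ (possibly empty). For $f: x \to y$ put $f^{\ast}(S) = \{ g: y \to \bullet \mid gf \in S\}$. A Grothendieck topology $J$ on $\mathscr{C}^{\mathrm{op}}$ assigns to each object $x$ a collection $J(x)$ of subfunctors of $\mathscr{C}(x,-)$ such that: $\mathscr{C}(x,-) \in J(x)$; $S \in J(x)$ implies $f^{\ast}(S) \in J(y)$ for every $f: x \to y$; and if $S \in J(x)$ and $T \subseteq \mathscr{C}(x,-)$ is a subfunctor with $f^{\ast}(T) \in J(y)$ for every $(f: x \to y) \in S$, then $T \in J(x)$. An object $x$ is $J$-irreducible if $J(x) = \{\mathscr{C}(x,-)\}$. For an object $y$ let $S_y \subseteq \mathscr{C}(y,-)$ be the subfunctor generated by all morphisms of $\mathscr{C}$ from $y$ to $J$-irreducible objects. $J$ is rigid if $S_y \in J(y)$ for every object $y$. *)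

theory Defs
  imports Main "HOL.Hull"
begin

text \<open>
  Objects and morphisms form sets, so every category below is small.
  \<^term>\<open>Comp C g f\<close> is the composite \<open>g f\<close> (first \<open>f\<close>, then \<open>g\<close>); it is only constrained
  when \<open>Cod f = Dom g\<close>.
\<close>

record ('o, 'm) cat =
  Ob   :: "'o set"
  Mor  :: "'m set"
  Dom  :: "'m \<Rightarrow> 'o"
  Cod  :: "'m \<Rightarrow> 'o"
  Ident :: "'o \<Rightarrow> 'm"
  Comp :: "'m \<Rightarrow> 'm \<Rightarrow> 'm"

definition Hom :: "('o, 'm, 'z) cat_scheme \<Rightarrow> 'o \<Rightarrow> 'o \<Rightarrow> 'm set" where
  "Hom C x y = {f \<in> Mor C. Dom C f = x \<and> Cod C f = y}"

locale category =
  fixes C :: "('o, 'm, 'z) cat_scheme"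
  assumes Dom_in_Ob: "f \<in> Mor C \<Longrightarrow> Dom C f \<in> Ob C"
    and Cod_in_Ob: "f \<in> Mor C \<Longrightarrow> Cod C f \<in> Ob C"
    and Ident_in_Hom: "x \<in> Ob C \<Longrightarrow> Ident C x \<in> Hom C x x"
    and Comp_in_Hom: "f \<in> Hom C x y \<Longrightarrow> g \<in> Hom C y z \<Longrightarrow> Comp C g f \<in> Hom C x z"
    and Comp_Ident: "f \<in> Hom C x y \<Longrightarrow> Comp C f (Ident C x) = f"
    and Ident_Comp: "f \<in> Hom C x y \<Longrightarrow> Comp C (Ident C y) f = f"
    and Comp_assoc: "f \<in> Hom C w x \<Longrightarrow> g \<in> Hom C x y \<Longrightarrow> h \<in> Hom C y z \<Longrightarrow>
          Comp C h (Comp C g f) = Comp C (Comp C h g) f"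

definition iso :: "('o, 'm, 'z) cat_scheme \<Rightarrow> 'm \<Rightarrow> bool" where
  "iso C f \<longleftrightarrow> f \<in> Mor C \<and>
     (\<exists>g \<in> Hom C (Cod C f) (Dom C f).
        Comp C g f = Ident C (Dom C f) \<and> Comp C f g = Ident C (Cod C f))"

definition skeletal :: "('o, 'm, 'z) cat_scheme \<Rightarrow> bool" where
  "skeletal C \<longleftrightarrow> (\<forall>x \<in> Ob C. \<forall>y \<in> Ob C. (\<exists>f \<in> Hom C x y. iso C f) \<longrightarrow> x = y)"

definition ob_le :: "('o, 'm, 'z) cat_scheme \<Rightarrow> 'o rel" where
  "ob_le C = {(x, y). x \<in> Ob C \<and> y \<in> Ob C \<and> Hom C x y \<noteq> {}}"

definition ascending_chain_condition :: "'a set \<Rightarrow> 'a rel \<Rightarrow> bool" where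
  "ascending_chain_condition A r \<longleftrightarrow>
     (\<forall>c :: nat \<Rightarrow> 'a. (\<forall>n. c n \<in> A) \<and> (\<forall>n. (c n, c (Suc n)) \<in> r) \<longrightarrow>
        (\<exists>N. \<forall>n \<ge> N. c n = c N))"

locale directed_category = category +
  assumes skeletal: "skeletal C"
    and partial_order: "partial_order_on (Ob C) (ob_le C)"

locale noetherian_EI_category = directed_category +
  assumes acc: "ascending_chain_condition (Ob C) (ob_le C)"
    and EI: "x \<in> Ob C \<Longrightarrow> f \<in> Hom C x x \<Longrightarrow> iso C f"

text \<open>
  A subfunctor \<open>S\<close> of the covariant functor \<open>C(x,-)\<close> is represented by the union over all
  objects \<open>y\<close> of the subsets \<open>S(y) \<subseteq> C(x,y)\<close>.  No information is lost, since \<open>S(y)\<close> consists of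
  the members of the union with codomain \<open>y\<close>, and stability under the maps \<open>C(x,g)\<close> is closure
  under postcomposition.
\<close>

definition corepresentable :: "('o, 'm, 'z) cat_scheme \<Rightarrow> 'o \<Rightarrow> 'm set" where
  "corepresentable C x = (\<Union>y \<in> Ob C. Hom C x y)"

definition subfunctor :: "('o, 'm, 'z) cat_scheme \<Rightarrow> 'o \<Rightarrow> 'm set \<Rightarrow> bool" where
  "subfunctor C x S \<longleftrightarrow> S \<subseteq> corepresentable C x \<and>
     (\<forall>y z f g. f \<in> S \<longrightarrow> f \<in> Hom C x y \<longrightarrow> g \<in> Hom C y z \<longrightarrow> Comp C g f \<in> S)"

definition pullback :: "('o, 'm, 'z) cat_scheme \<Rightarrow> 'm \<Rightarrow> 'm set \<Rightarrow> 'm set" where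
  "pullback C f S = {g \<in> corepresentable C (Cod C f). Comp C g f \<in> S}"

text \<open>
  Topologies on the opposite category, hence sieves of morphisms going \<^emph>\<open>out of\<close> \<open>x\<close>.
\<close>

definition grothendieck_topology_op ::
    "('o, 'm, 'z) cat_scheme \<Rightarrow> ('o \<Rightarrow> 'm set set) \<Rightarrow> bool" where
  "grothendieck_topology_op C J \<longleftrightarrow>
     (\<forall>x \<in> Ob C. \<forall>S \<in> J x. subfunctor C x S) \<and>
     (\<forall>x \<in> Ob C. corepresentable C x \<in> J x) \<and>
     (\<forall>x \<in> Ob C. \<forall>S \<in> J x. \<forall>y \<in> Ob C. \<forall>f \<in> Hom C x y. pullback C f S \<in> J y) \<and>
     (\<forall>x \<in> Ob C. \<forall>S \<in> J x. \<forall>T. subfunctor C x T \<longrightarrow>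
        (\<forall>y \<in> Ob C. \<forall>f \<in> Hom C x y. f \<in> S \<longrightarrow> pullback C f T \<in> J y) \<longrightarrow> T \<in> J x)"

definition irreducible ::
    "('o, 'm, 'z) cat_scheme \<Rightarrow> ('o \<Rightarrow> 'm set set) \<Rightarrow> 'o \<Rightarrow> bool" where
  "irreducible C J x \<longleftrightarrow> x \<in> Ob C \<and> J x = {corepresentable C x}"

definition irreducible_sieve ::
    "('o, 'm, 'z) cat_scheme \<Rightarrow> ('o \<Rightarrow> 'm set set) \<Rightarrow> 'o \<Rightarrow> 'm set" where
  "irreducible_sieve C J y =
     subfunctor C y hull (\<Union>x \<in> {x. irreducible C J x}. Hom C y x)"

definition rigid :: "('o, 'm, 'z) cat_scheme \<Rightarrow> ('o \<Rightarrow> 'm set set) \<Rightarrow> bool" where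
  "rigid C J \<longleftrightarrow> (\<forall>y \<in> Ob C. irreducible_sieve C J y \<in> J y)"

end

theory Submission
  imports Defs
begin

text \<open>
  Noetherian induction from above.  If \<open>y\<close> is irreducible, then \<open>S\<^sub>y\<close> contains the identity.
  Otherwise some covering sieve \<open>S\<close> on \<open>y\<close> is proper; endomorphisms being invertible, a proper
  sieve contains no endomorphism, so every \<open>f: y \<rightarrow> z\<close> in \<open>S\<close> ends at an object strictly above
  \<open>y\<close>.  There \<open>S\<^sub>z\<close> covers by induction, and it is contained in the pullback of \<open>S\<^sub>y\<close> along \<open>f\<close>;
  transitivity of the topology gives that \<open>S\<^sub>y\<close> covers.
\<close>

lemma mem_corepresentableI: "f \<in> Hom C x y \<Longrightarrow> y \<in> Ob C \<Longrightarrow> f \<in> corepresentable C x"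
  by (auto simp: corepresentable_def)

lemma subfunctor_subset: "subfunctor C x S \<Longrightarrow> S \<subseteq> corepresentable C x"
  by (simp add: subfunctor_def)

lemma subfunctor_comp:
  "subfunctor C x S \<Longrightarrow> f \<in> S \<Longrightarrow> f \<in> Hom C x y \<Longrightarrow> g \<in> Hom C y z \<Longrightarrow> Comp C g f \<in> S"
  by (auto simp: subfunctor_def)

text \<open>The pairs are reversed so that well-founded induction supplies the claim for all
  strictly larger elements. An infinite descending chain would be an ascending
  \<open>r\<close>-chain without equal neighbours, but the chain condition makes it constant from
  some \<open>N\<close> on.\<close>

lemma wf_of_acc:
  assumes "ascending_chain_condition A r" "r \<subseteq> A \<times> A"
  shows "wf {(z, y). (y, z) \<in> r \<and> y \<noteq> z}"
  unfolding wf_iff_no_infinite_down_chain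
proof
  assume "\<exists>c. \<forall>i. (c (Suc i), c i) \<in> {(z, y). (y, z) \<in> r \<and> y \<noteq> z}"
  then obtain c where c: "\<And>i. (c i, c (Suc i)) \<in> r" "\<And>i. c i \<noteq> c (Suc i)"
    by auto
  with assms obtain N where "\<forall>n\<ge>N. c n = c N"
    unfolding ascending_chain_condition_def by blast
  with c(2)[of N] show False
    by (metis le_SucI order_refl)
qed

context category
begin

lemma Hom_Ob:
  assumes "f \<in> Hom C x y"
  shows "x \<in> Ob C" "y \<in> Ob C"
  using assms Dom_in_Ob Cod_in_Ob by (auto simp: Hom_def)

lemma subfunctor_corepresentable: "subfunctor C x (corepresentable C x)"
  unfolding subfunctor_def
proof (intro conjI allI impI)
  fix y z f g assume "f \<in> Hom C x y" "g \<in> Hom C y z"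
  then show "Comp C g f \<in> corepresentable C x"
    using Comp_in_Hom Hom_Ob(2) mem_corepresentableI by metis
qed simp

text \<open>Closure under postcomposition passes to intersections. The hypothesis makes
  \<open>corepresentable C x\<close> one of the sets intersected; otherwise the family would be
  empty and the hull would be \<open>UNIV\<close>.\<close>

lemma subfunctor_hull:
  assumes "G \<subseteq> corepresentable C x"
  shows "subfunctor C x (subfunctor C x hull G)"
proof -
  have "subfunctor C x hull G \<subseteq> corepresentable C x"
    using assms subfunctor_corepresentable by (simp add: hull_minimal)
  moreover have "Comp C g f \<in> subfunctor C x hull G"
    if "f \<in> subfunctor C x hull G" "f \<in> Hom C x y" "g \<in> Hom C y z" for f g y z
    using that(1) subfunctor_comp[OF _ _ that(2,3)] unfolding hull_def by simp
  ultimately show ?thesis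
    unfolding subfunctor_def by blast
qed

lemma subfunctor_eq_corepresentable:
  assumes "subfunctor C x S" "Ident C x \<in> S" "x \<in> Ob C"
  shows "S = corepresentable C x"
proof
  show "S \<subseteq> corepresentable C x"
    using assms(1) by (rule subfunctor_subset)
  show "corepresentable C x \<subseteq> S"
  proof
    fix f assume "f \<in> corepresentable C x"
    then obtain y where f: "f \<in> Hom C x y"
      by (auto simp: corepresentable_def)
    have "Comp C f (Ident C x) \<in> S"
      using subfunctor_comp[OF assms(1,2) Ident_in_Hom[OF assms(3)] f] .
    then show "f \<in> S"
      using f by (simp add: Comp_Ident)
  qed
qed

lemma subfunctor_pullback:
  assumes S: "subfunctor C x S" and f: "f \<in> Hom C x y"
  shows "subfunctor C y (pullback C f S)"
proof -
  have cod: "Cod C f = y"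
    using f by (simp add: Hom_def)
  have "Comp C h g \<in> pullback C f S"
    if g: "g \<in> pullback C f S" "g \<in> Hom C y z" and h: "h \<in> Hom C z w" for g h z w
  proof -
    have "Comp C h (Comp C g f) \<in> S"
      using g(1) subfunctor_comp[OF S _ Comp_in_Hom[OF f g(2)] h] by (simp add: pullback_def)
    then have "Comp C (Comp C h g) f \<in> S"
      using Comp_assoc[OF f g(2) h] by simp
    moreover have "Comp C h g \<in> corepresentable C y"
      using mem_corepresentableI[OF Comp_in_Hom[OF g(2) h]] Hom_Ob(2)[OF h] by simp
    ultimately show ?thesis
      using cod by (simp add: pullback_def)
  qed
  then show ?thesis
    unfolding subfunctor_def using cod by (auto simp: pullback_def)
qed

lemma pullback_eq_corepresentable:
  assumes S: "subfunctor C x S" and f: "f \<in> Hom C x y" "f \<in> S"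
  shows "pullback C f S = corepresentable C y"
proof -
  have cod: "Cod C f = y"
    using f by (simp add: Hom_def)
  show ?thesis
    using subfunctor_comp[OF S f(2,1)] cod
    by (auto simp: pullback_def corepresentable_def)
qed

lemma subfunctor_irreducible_sieve: "subfunctor C y (irreducible_sieve C J y)"
  unfolding irreducible_sieve_def
  by (rule subfunctor_hull) (auto simp: irreducible_def intro: mem_corepresentableI)

lemma mem_irreducible_sieve:
  "irreducible C J x \<Longrightarrow> f \<in> Hom C y x \<Longrightarrow> f \<in> irreducible_sieve C J y"
  unfolding irreducible_sieve_def by (rule hull_inc) blast

text \<open>Precomposing a generator of the left side with \<open>f\<close> keeps its irreducible
  codomain, so it yields a generator of the sieve on \<open>y\<close>. Since the pullback is itself
  a subfunctor, it suffices to check generators.\<close>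

lemma irreducible_sieve_subset_pullback:
  assumes f: "f \<in> Hom C y z"
  shows "irreducible_sieve C J z \<subseteq> pullback C f (irreducible_sieve C J y)"
proof -
  have cod: "Cod C f = z"
    using f by (simp add: Hom_def)
  have "(\<Union>x \<in> {x. irreducible C J x}. Hom C z x) \<subseteq> pullback C f (irreducible_sieve C J y)"
    using f cod
    by (auto simp: pullback_def intro: mem_irreducible_sieve Comp_in_Hom mem_corepresentableI dest: Hom_Ob(2))
  then show ?thesis
    unfolding irreducible_sieve_def[of C J z]
    by (rule hull_minimal) (rule subfunctor_pullback[OF subfunctor_irreducible_sieve f])
qed

context
  fixes J
  assumes J: "grothendieck_topology_op C J"
begin

lemma covering_subfunctor: "x \<in> Ob C \<Longrightarrow> S \<in> J x \<Longrightarrow> subfunctor C x S"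
  using J by (simp add: grothendieck_topology_op_def)

lemma covering_corepresentable: "x \<in> Ob C \<Longrightarrow> corepresentable C x \<in> J x"
  using J by (simp add: grothendieck_topology_op_def)

lemma covering_trans:
  assumes "x \<in> Ob C" "S \<in> J x" "subfunctor C x T"
    and "\<And>y f. f \<in> Hom C x y \<Longrightarrow> f \<in> S \<Longrightarrow> pullback C f T \<in> J y"
  shows "T \<in> J x"
proof -
  have "\<forall>x \<in> Ob C. \<forall>S \<in> J x. \<forall>T. subfunctor C x T \<longrightarrow>
      (\<forall>y \<in> Ob C. \<forall>f \<in> Hom C x y. f \<in> S \<longrightarrow> pullback C f T \<in> J y) \<longrightarrow> T \<in> J x"
    using J unfolding grothendieck_topology_op_def by (elim conjE)
  with assms show ?thesis
    by simp
qed

text \<open>Along any \<open>f\<close> in \<open>S\<close> the larger sieve \<open>T\<close> pulls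
  back to the maximal sieve, so transitivity applies.\<close>

lemma covering_mono:
  assumes "x \<in> Ob C" "S \<in> J x" "subfunctor C x T" "S \<subseteq> T"
  shows "T \<in> J x"
  using assms(1-3)
proof (rule covering_trans)
  fix y f assume f: "f \<in> Hom C x y" "f \<in> S"
  then have "pullback C f T = corepresentable C y"
    using assms pullback_eq_corepresentable by blast
  then show "pullback C f T \<in> J y"
    using covering_corepresentable[OF Hom_Ob(2)[OF f(1)]] by simp
qed

end

end

text \<open>Postcomposing \<open>f\<close> with its inverse puts the identity into
  \<open>S\<close>.\<close>

lemma (in noetherian_EI_category) endo_mem_imp_eq_corepresentable:
  assumes S: "subfunctor C x S" and f: "f \<in> S" "f \<in> Hom C x x"
  shows "S = corepresentable C x"
proof -
  have x: "x \<in> Ob C"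
    using f(2) by (rule Hom_Ob)
  have "iso C f"
    using x f(2) by (rule EI)
  then obtain g where "g \<in> Hom C x x" "Comp C g f = Ident C x"
    using f(2) by (auto simp: iso_def Hom_def)
  then have "Ident C x \<in> S"
    using subfunctor_comp[OF S f, of g x] by simp
  then show ?thesis
    using S x by (simp add: subfunctor_eq_corepresentable)
qed

lemma (in noetherian_EI_category) irreducible_sieve_covering:
  assumes J: "grothendieck_topology_op C J"
  shows "y \<in> Ob C \<Longrightarrow> irreducible_sieve C J y \<in> J y"
proof (induction y rule: wf_induct_rule[OF wf_of_acc[OF acc]])
  \<comment> \<open>This is the side condition of \<open>wf_of_acc\<close> that
    \<open>ob_le C\<close> relates only objects of \<open>C\<close>.\<close>
  case 1
  show ?case
    by (auto simp: ob_le_def)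
next
  case (2 y)
  note sub = subfunctor_irreducible_sieve[of y J]
  show ?case
  proof (cases "irreducible C J y")
    case True
    then have "Ident C y \<in> irreducible_sieve C J y"
      using 2 by (simp add: mem_irreducible_sieve Ident_in_Hom)
    then have "irreducible_sieve C J y = corepresentable C y"
      using sub \<open>y \<in> Ob C\<close> by (simp add: subfunctor_eq_corepresentable)
    then show ?thesis
      using \<open>y \<in> Ob C\<close> by (simp add: covering_corepresentable[OF J])
  next
    case False
    \<comment> \<open>The maximal sieve always lies in \<open>J y\<close>, so a reducible
      \<open>y\<close> must have a second covering sieve.\<close>
    then obtain S where S: "S \<in> J y" "S \<noteq> corepresentable C y"
      using 2 covering_corepresentable[OF J] by (auto simp: irreducible_def)
    have S_sub: "subfunctor C y S"
      using 2 S by (simp add: covering_subfunctor[OF J])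
    show ?thesis
    proof (rule covering_trans[OF J \<open>y \<in> Ob C\<close> S(1) sub])
      fix z f assume f: "f \<in> Hom C y z" "f \<in> S"
      then have "y \<noteq> z"
        using endo_mem_imp_eq_corepresentable[OF S_sub] S by blast
      moreover have z: "z \<in> Ob C"
        using f(1) by (rule Hom_Ob)
      \<comment> \<open>The morphism \<open>f\<close> witnesses that \<open>z\<close> is above
        \<open>y\<close>, so the induction hypothesis applies to \<open>z\<close>.\<close>
      ultimately have "irreducible_sieve C J z \<in> J z"
        using 2 f by (auto simp: ob_le_def)
      then show "pullback C f (irreducible_sieve C J y) \<in> J z"
        using covering_mono[OF J z] subfunctor_pullback[OF sub f(1)]
          irreducible_sieve_subset_pullback[OF f(1)] by blast
    qed
  qed
qed

theorem corollary5p17: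
  fixes C :: "('o, 'm) cat" and J :: "'o \<Rightarrow> 'm set set"
  assumes "noetherian_EI_category C"
    and "grothendieck_topology_op C J"
  shows "rigid C J"
  using noetherian_EI_category.irreducible_sieve_covering[OF assms] by (simp add: rigid_def)

end
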